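(* Let $m \ge 2$ and $x \geq 1$ be integers, let $G$ be a simple connected graph of order $n$, and let $D_m^x(G)$ be its $(m,x)$-shadow. Consider the following conditions, for some nonnegative integers $d'_x, \lambda'_x, \mu'_x$: (1) for all $v \in V(G)$, $|N(v)| + (m-1)|N^x(v)| = d'_x$; (2) for all $u,v \in V(G)$ with $u \sim v$ in $G$, $|N(u) \cap N(v)| + (m-1)|N^x(u) \cap N^x(v)| = \lambda'_x$; (3) for all $v,w \in V(G)$ with $w \in N^x(v)$, $|N(v) \cap N^x(w)| + |N^x(v) \cap N(w)| + (m-2)|N^x(v) \cap N^x(w)| = \lambda'_x$; (4) for all distinct $u,v \in V(G)$ with $u \not\sim v$ in $G$, $|N(u) \cap N(v)| + (m-1)|N^x(u) \cap N^x(v)| = \mu'_x$; (5) for all $v,w \in V(G)$ with $w \notin N^x(v)$, $|N(v) \cap N^x(w)| + |N^x(v) \cap N(w)| + (m-2)|N^x(v) \cap N^x(w)| = \mu'_x$. Then: condition (1) holds if and only if $D_m^x(G)$ is regular of degree $d'_x$; conditions (1), (2), (3) hold if and only if $D_m^x(G) \in ER(mn, d'_x, \lambda'_x)$; and conditions (1)–(5) all hold if and only if $D_m^x(G) \in SR(mn, d'_x, \lambda'_x, \mu'_x)$.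
   Context: All graphs are finite and simple. For a vertex $v$ of $G$, $N(v)$ is its neighborhood and, for a positive integer $x$, $N^x(v)$ is the set of vertices at distance exactly $x$ from $v$ in $G$. A graph is edge-regular if it is regular and there is $\lambda \ge 0$ such that every two adjacent vertices have exactly $\lambda$ common neighbors; $ER(n,d,\lambda)$ denotes the set of edge-regular graphs on $n$ vertices, regular of degree $d$, with parameter $\lambda$. $SR(n,d,\lambda,\mu)$ denotes the set of graphs in $ER(n,d,\lambda)$ in which any two distinct nonadjacent vertices have exactly $\mu$ common neighbors. For $x \ge 1$ and $m \ge 2$, the $(m,x)$-shadow $D_m^x(G)$ is the simple graph whose vertex set is the disjoint union of $m$ copies $G_1,\dots,G_m$ of $G$ (the copy of $u\in V(G)$ in $G_i$ denoted $u_i$), with edges $u_iv_i$ for $1\le i\le m$ and $uv \in E(G)$, and edges $u_iv_j$ for $1 \le i < j \le m$ whenever $u \in N^x(v)$. *)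

theory Defs
  imports "Graph_Theory.Graph_Theory"
begin

text \<open>
  A finite simple graph is a \<^locale>\<open>pair_graph\<close>: a finite, symmetric, loop-free digraph without
  parallel arcs. An edge \<open>uv\<close> is the pair of arcs \<open>(u, v)\<close>, \<open>(v, u)\<close>, and the degree of \<open>v\<close> is
  its out-degree.
\<close>

definition nbhd :: "'a pair_pre_digraph \<Rightarrow> 'a \<Rightarrow> 'a set" where
  "nbhd G v = {u \<in> pverts G. v \<rightarrow>\<^bsub>with_proj G\<^esub> u}"

text \<open>The graph distance is the shortest-walk cost with all arcs of weight 1.\<close>

definition gdist :: "'a pair_pre_digraph \<Rightarrow> 'a \<Rightarrow> 'a \<Rightarrow> ereal" where
  "gdist G u v = wf_digraph.\<mu> (with_proj G) (\<lambda>_. 1) u v"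

definition dist_nbhd :: "'a pair_pre_digraph \<Rightarrow> nat \<Rightarrow> 'a \<Rightarrow> 'a set" where
  "dist_nbhd G x v = {u \<in> pverts G. gdist G v u = ereal (real x)}"

definition regular_of_degree :: "'a pair_pre_digraph \<Rightarrow> nat \<Rightarrow> bool" where
  "regular_of_degree G d \<longleftrightarrow> (\<forall>v \<in> pverts G. out_degree (with_proj G) v = d)"

text \<open>
  The condition on \<open>\<lambda>\<close> (resp. \<open>\<mu>\<close>) is vacuous for graphs without edges (resp. complete graphs),
  which therefore belong to these sets for every value of that parameter.
\<close>

definition ER :: "nat \<Rightarrow> nat \<Rightarrow> nat \<Rightarrow> 'a pair_pre_digraph set" where
  "ER n d l = {G. pair_graph G \<and> card (pverts G) = n \<and> regular_of_degree G d \<and>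
     (\<forall>u \<in> pverts G. \<forall>v \<in> pverts G. u \<rightarrow>\<^bsub>with_proj G\<^esub> v \<longrightarrow> card (nbhd G u \<inter> nbhd G v) = l)}"

definition SR :: "nat \<Rightarrow> nat \<Rightarrow> nat \<Rightarrow> nat \<Rightarrow> 'a pair_pre_digraph set" where
  "SR n d l k = {G \<in> ER n d l.
     \<forall>u \<in> pverts G. \<forall>v \<in> pverts G.
       u \<noteq> v \<and> \<not> u \<rightarrow>\<^bsub>with_proj G\<^esub> v \<longrightarrow> card (nbhd G u \<inter> nbhd G v) = k}"

text \<open>
  The copy \<open>u\<^sub>i\<close> of \<open>u\<close> is \<open>(u, i)\<close>. The second group of arcs joins different copies; its
  converse is added so that every edge is present as two arcs.
\<close>

definition shadow :: "nat \<Rightarrow> nat \<Rightarrow> 'a pair_pre_digraph \<Rightarrow> ('a \<times> nat) pair_pre_digraph" where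
  "shadow m x G =
    (let C = {((u, i), (v, j)) | u v i j.
                u \<in> pverts G \<and> v \<in> pverts G \<and> 1 \<le> i \<and> i < j \<and> j \<le> m \<and> u \<in> dist_nbhd G x v}
     in \<lparr> pverts = pverts G \<times> {1..m},
          parcs = {((u, i), (v, i)) | u v i. 1 \<le> i \<and> i \<le> m \<and> u \<rightarrow>\<^bsub>with_proj G\<^esub> v} \<union> C \<union> C\<inverse> \<rparr>)"

end

theory Submission
  imports Defs
begin

text \<open>
  In the shadow, the neighborhood of the copy \<open>u\<^sub>i\<close> consists of the copies in layer \<open>i\<close> of the
  neighbors of \<open>u\<close> together with the copies in every other layer of the vertices at distance \<open>x\<close>
  from \<open>u\<close>. Intersecting two such sets and counting layer by layer gives the left-hand sides of
  the five conditions: (1) is the degree, (2) and (4) concern two vertices in the same layer,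
  (3) and (5) two vertices in different layers.
\<close>

lemma mem_nbhd_iff:
  assumes "pair_graph G"
  shows "v \<in> nbhd G u \<longleftrightarrow> (u, v) \<in> parcs G"
proof -
  interpret pair_graph G by fact
  show ?thesis
    by (auto simp: nbhd_def dest: in_arcsD2)
qed

text \<open>Degree counts arcs, while the five conditions count vertices. An arc is a pair, so its
  head determines it once the tail \<open>u\<close> is fixed.\<close>

lemma card_nbhd_eq_out_degree:
  assumes "pair_graph G"
  shows "card (nbhd G u) = out_degree (with_proj G) u"
proof -
  have "out_arcs (with_proj G) u = Pair u ` nbhd G u"
    by (auto simp: out_arcs_def mem_nbhd_iff[OF assms])
  then show ?thesis
    by (simp add: out_degree_def card_image inj_on_def)
qed

text \<open>Reversal swaps the ends of each arc, which leaves the cost unchanged because the weight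
  is constant.\<close>

lemma (in pair_wf_digraph) awalk_cost_rev_path:
  "awalk_cost (\<lambda>_. c) (rev_path p) = awalk_cost (\<lambda>_. c) p"
  by (induction p) simp_all

text \<open>Every walk from \<open>b\<close> to \<open>a\<close> reverses to a walk from
  \<open>a\<close> to \<open>b\<close> of the same cost, so one infimum is bounded by the other. As
  \<open>a\<close> and \<open>b\<close> are arbitrary, antisymmetry finishes.\<close>

lemma gdist_commute:
  assumes "pair_graph G"
  shows "gdist G u v = gdist G v u"
proof -
  interpret pair_graph G by fact
  have "gdist G a b \<le> gdist G b a" for a b
    unfolding gdist_def \<mu>_def
  proof (rule INF_greatest)
    fix p assume "p \<in> {p. awalk b p a}"
    then have "awalk a (rev_path p) b"
      by simp
    then show "(INF p\<in>{p. awalk a p b}. ereal (awalk_cost (\<lambda>_. 1) p)) \<le> ereal (awalk_cost (\<lambda>_. 1) p)"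
      by (intro INF_lower2[of "rev_path p"]) (auto simp: awalk_cost_rev_path)
  qed
  then show ?thesis
    by (intro antisym)
qed

lemma dist_nbhd_commute:
  assumes "pair_graph G" "u \<in> pverts G" "v \<in> pverts G"
  shows "u \<in> dist_nbhd G x v \<longleftrightarrow> v \<in> dist_nbhd G x u"
  using assms(2,3) gdist_commute[OF assms(1)] by (auto simp: dist_nbhd_def)

lemma pverts_shadow [simp]: "pverts (shadow m x G) = pverts G \<times> {1..m}"
  by (simp add: shadow_def Let_def)

text \<open>Symmetry of the distance removes the orientation \<open>i < j\<close> from the
  definition: \<open>C\<close> and its converse together join any two different layers by the same
  relation.\<close>

lemma parcs_shadow_iff:
  assumes "pair_graph G"
  shows "((u, i), (v, j)) \<in> parcs (shadow m x G) \<longleftrightarrow>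
    u \<in> pverts G \<and> v \<in> pverts G \<and> i \<in> {1..m} \<and> j \<in> {1..m} \<and>
    (if i = j then (u, v) \<in> parcs G else v \<in> dist_nbhd G x u)"
proof -
  interpret pair_graph G by fact
  show ?thesis
    using dist_nbhd_commute[OF assms, of u v x]
    by (auto simp: shadow_def Let_def dest: in_arcsD1 in_arcsD2)
qed

text \<open>Membership in \<open>ER\<close> includes being a simple graph. A loop would have to lie
  inside one layer, where it would come from a loop of \<open>G\<close>.\<close>

lemma pair_graph_shadow:
  assumes "pair_graph G"
  shows "pair_graph (shadow m x G)"
proof -
  interpret pair_graph G by fact
  let ?S = "shadow m x G"
  have sub: "parcs ?S \<subseteq> pverts ?S \<times> pverts ?S"
    by (auto simp: parcs_shadow_iff[OF assms])
  have fin: "finite (pverts ?S)"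
    using pair_finite_verts by simp
  show ?thesis
  proof
    show "finite (parcs ?S)"
      using sub fin finite_subset by blast
    show "symmetric (with_proj ?S)"
      by (auto simp: symmetric_def sym_def parcs_shadow_iff[OF assms] dist_nbhd_commute[OF assms]
          split: if_splits intro: arcs_symmetric)
    show "fst e \<noteq> snd e" if "e \<in> parcs ?S" for e
      using that by (cases e) (auto simp: parcs_shadow_iff[OF assms] dest: no_loops')
  qed (use sub fin in auto)
qed

lemma nbhd_shadow:
  assumes "pair_graph G" "u \<in> pverts G" "i \<in> {1..m}"
  shows "nbhd (shadow m x G) (u, i) = nbhd G u \<times> {i} \<union> dist_nbhd G x u \<times> ({1..m} - {i})"
proof -
  interpret pair_graph G by fact
  show ?thesis
    using assms(2,3) in_arcsD2[of u]
    by (auto simp: mem_nbhd_iff[OF pair_graph_shadow] mem_nbhd_iff parcs_shadow_iff assms(1)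
        dist_nbhd_def split: if_splits)
qed

context
  fixes G :: "'a pair_pre_digraph" and m x :: nat
  assumes graph: "pair_graph G"
begin

lemma finite_nbhd: "finite (nbhd G u)" and finite_dist_nbhd: "finite (dist_nbhd G x u)"
proof -
  interpret pair_graph G by (fact graph)
  show "finite (nbhd G u)" "finite (dist_nbhd G x u)"
    using pair_finite_verts by (auto simp: nbhd_def dist_nbhd_def)
qed

text \<open>The two blocks are disjoint because their layers differ, even where
  \<open>nbhd G u\<close> and \<open>dist_nbhd G x u\<close> overlap, as they do for
  \<open>x = 1\<close>.\<close>

lemma card_nbhd_shadow:
  assumes "u \<in> pverts G" "i \<in> {1..m}"
  shows "card (nbhd (shadow m x G) (u, i)) = card (nbhd G u) + (m - 1) * card (dist_nbhd G x u)"
  using assms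
  by (simp add: nbhd_shadow[OF graph] card_Un_disjoint card_cartesian_product Times_Int_Times
      finite_nbhd finite_dist_nbhd)

lemma card_common_nbhd_same_layer:
  assumes "u \<in> pverts G" "v \<in> pverts G" "i \<in> {1..m}"
  shows "card (nbhd (shadow m x G) (u, i) \<inter> nbhd (shadow m x G) (v, i)) =
    card (nbhd G u \<inter> nbhd G v) + (m - 1) * card (dist_nbhd G x u \<inter> dist_nbhd G x v)"
proof -
  have "nbhd (shadow m x G) (u, i) \<inter> nbhd (shadow m x G) (v, i) =
      (nbhd G u \<inter> nbhd G v) \<times> {i} \<union> (dist_nbhd G x u \<inter> dist_nbhd G x v) \<times> ({1..m} - {i})"
    using assms by (auto simp: nbhd_shadow[OF graph])
  then show ?thesis
    using assms(3)
    by (simp add: card_Un_disjoint card_cartesian_product Times_Int_Times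
        finite_nbhd finite_dist_nbhd)
qed

text \<open>Layer \<open>i\<close> is home to \<open>u\<close> and foreign to \<open>v\<close>,
  layer \<open>j\<close> the reverse; these give the two mixed terms. All remaining layers are
  foreign to both.\<close>

lemma card_common_nbhd_distinct_layers:
  assumes "u \<in> pverts G" "v \<in> pverts G" "i \<in> {1..m}" "j \<in> {1..m}" "i \<noteq> j"
  shows "card (nbhd (shadow m x G) (u, i) \<inter> nbhd (shadow m x G) (v, j)) =
    card (nbhd G u \<inter> dist_nbhd G x v) + card (dist_nbhd G x u \<inter> nbhd G v)
      + (m - 2) * card (dist_nbhd G x u \<inter> dist_nbhd G x v)"
proof -
  have "nbhd (shadow m x G) (u, i) \<inter> nbhd (shadow m x G) (v, j) =
      (nbhd G u \<inter> dist_nbhd G x v) \<times> {i} \<union> (dist_nbhd G x u \<inter> nbhd G v) \<times> {j}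
        \<union> (dist_nbhd G x u \<inter> dist_nbhd G x v) \<times> ({1..m} - {i, j})"
    using assms by (auto simp: nbhd_shadow[OF graph])
  \<comment> \<open>Two distinct indices in \<open>{1..m}\<close> force m \<ge> 2, so the
    subtraction does not truncate.\<close>
  moreover have "card ({1..m} - {i, j}) = m - 2"
    using assms(3-5) by (subst card_Diff_subset) auto
  ultimately show ?thesis
    using assms(5)
    by (simp add: card_Un_disjoint card_cartesian_product Times_Int_Times Int_Un_distrib2
        finite_nbhd finite_dist_nbhd)
qed

end

theorem theorem2p6:
  fixes G :: "'a pair_pre_digraph" and m x n d l k :: nat
    and c1 c2 c3 c4 c5 :: bool
  assumes m: "m \<ge> 2" and x: "x \<ge> 1"
    and graph: "pair_graph G"
    and conn: "Digraph_Component.connected (with_proj G)"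
    and order: "card (pverts G) = n"
  defines "c1 \<equiv> \<forall>v \<in> pverts G. card (nbhd G v) + (m - 1) * card (dist_nbhd G x v) = d"
    and "c2 \<equiv> \<forall>u \<in> pverts G. \<forall>v \<in> pverts G. u \<rightarrow>\<^bsub>with_proj G\<^esub> v \<longrightarrow>
           card (nbhd G u \<inter> nbhd G v) + (m - 1) * card (dist_nbhd G x u \<inter> dist_nbhd G x v) = l"
    and "c3 \<equiv> \<forall>v \<in> pverts G. \<forall>w \<in> pverts G. w \<in> dist_nbhd G x v \<longrightarrow>
           card (nbhd G v \<inter> dist_nbhd G x w) + card (dist_nbhd G x v \<inter> nbhd G w)
             + (m - 2) * card (dist_nbhd G x v \<inter> dist_nbhd G x w) = l"
    and "c4 \<equiv> \<forall>u \<in> pverts G. \<forall>v \<in> pverts G. u \<noteq> v \<and> \<not> u \<rightarrow>\<^bsub>with_proj G\<^esub> v \<longrightarrow>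
           card (nbhd G u \<inter> nbhd G v) + (m - 1) * card (dist_nbhd G x u \<inter> dist_nbhd G x v) = k"
    and "c5 \<equiv> \<forall>v \<in> pverts G. \<forall>w \<in> pverts G. w \<notin> dist_nbhd G x v \<longrightarrow>
           card (nbhd G v \<inter> dist_nbhd G x w) + card (dist_nbhd G x v \<inter> nbhd G w)
             + (m - 2) * card (dist_nbhd G x v \<inter> dist_nbhd G x w) = k"
  shows "(c1 \<longleftrightarrow> regular_of_degree (shadow m x G) d)
    \<and> (c1 \<and> c2 \<and> c3 \<longleftrightarrow> shadow m x G \<in> ER (m * n) d l)
    \<and> (c1 \<and> c2 \<and> c3 \<and> c4 \<and> c5 \<longleftrightarrow> shadow m x G \<in> SR (m * n) d l k)"
proof -
  let ?S = "shadow m x G"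
  note S = pair_graph_shadow[OF graph, of m x]
  note deg = card_nbhd_shadow[OF graph, of _ _ m x]
  note same = card_common_nbhd_same_layer[OF graph, of _ _ _ m x]
  note dist = card_common_nbhd_distinct_layers[OF graph, of _ _ _ m _ x]
  \<comment> \<open>These layers are the witnesses for recovering the conditions from the shadow:
    layer 1 alone for (1), (2) and (4), layers 1 and 2 together for (3) and (5).\<close>
  have layers: "1 \<in> {1..m}" "2 \<in> {1..m}" "(1::nat) \<noteq> 2"
    using m by auto
  have card_S: "card (pverts ?S) = m * n"
    by (simp add: order card_cartesian_product)
  have same_adj: "(u, i) \<rightarrow>\<^bsub>with_proj ?S\<^esub> (v, i) \<longleftrightarrow> u \<rightarrow>\<^bsub>with_proj G\<^esub> v"
    if "u \<in> pverts G" "v \<in> pverts G" "i \<in> {1..m}" for u v i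
    using that by (simp add: parcs_shadow_iff[OF graph])
  have dist_adj: "(u, i) \<rightarrow>\<^bsub>with_proj ?S\<^esub> (v, j) \<longleftrightarrow> v \<in> dist_nbhd G x u"
    if "u \<in> pverts G" "v \<in> pverts G" "i \<in> {1..m}" "j \<in> {1..m}" "i \<noteq> j" for u v i j
    using that by (simp add: parcs_shadow_iff[OF graph])
  have regular: "c1 \<longleftrightarrow> regular_of_degree ?S d"
    using layers(1) deg
    by (fastforce simp: c1_def regular_of_degree_def card_nbhd_eq_out_degree[OF S, symmetric])
  have adjacent: "c2 \<and> c3 \<longleftrightarrow> (\<forall>p \<in> pverts ?S. \<forall>q \<in> pverts ?S.
      p \<rightarrow>\<^bsub>with_proj ?S\<^esub> q \<longrightarrow> card (nbhd ?S p \<inter> nbhd ?S q) = l)" (is "_ \<longleftrightarrow> ?adj")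
  proof
    assume c: "c2 \<and> c3"
    show ?adj
    proof (intro ballI impI)
      fix p q
      assume pq: "p \<in> pverts ?S" "q \<in> pverts ?S" "p \<rightarrow>\<^bsub>with_proj ?S\<^esub> q"
      obtain u i v j where "p = (u, i)" "q = (v, j)"
        by (cases p, cases q)
      then show "card (nbhd ?S p \<inter> nbhd ?S q) = l"
        using pq c same_adj[of u v i] dist_adj[of u v i j] same[of u v i] dist[of u v i j]
        \<comment> \<open>An edge inside a layer comes from an edge of \<open>G\<close> and falls
          under (2); an edge between layers joins vertices at distance \<open>x\<close> and falls
          under (3).\<close>
        by (cases "i = j") (auto simp: c2_def c3_def)
    qed
  next
    assume adj: ?adj
    have c2
      unfolding c2_def
    proof (intro ballI impI)
      fix u v assume "u \<in> pverts G" "v \<in> pverts G" "u \<rightarrow>\<^bsub>with_proj G\<^esub> v"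
      then show "card (nbhd G u \<inter> nbhd G v) + (m - 1) * card (dist_nbhd G x u \<inter> dist_nbhd G x v) = l"
        using layers same_adj[of u v 1] same[of u v 1] adj[rule_format, of "(u, 1)" "(v, 1)"] by simp
    qed
    moreover have c3
      unfolding c3_def
    proof (intro ballI impI)
      fix v w assume "v \<in> pverts G" "w \<in> pverts G" "w \<in> dist_nbhd G x v"
      then show "card (nbhd G v \<inter> dist_nbhd G x w) + card (dist_nbhd G x v \<inter> nbhd G w)
          + (m - 2) * card (dist_nbhd G x v \<inter> dist_nbhd G x w) = l"
        using layers dist_adj[of v w 1 2] dist[of v w 1 2] adj[rule_format, of "(v, 1)" "(w, 2)"]
        by simp
    qed
    ultimately show "c2 \<and> c3" ..
  qed
  have nonadjacent: "c4 \<and> c5 \<longleftrightarrow> (\<forall>p \<in> pverts ?S. \<forall>q \<in> pverts ?S.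
      p \<noteq> q \<and> \<not> p \<rightarrow>\<^bsub>with_proj ?S\<^esub> q \<longrightarrow> card (nbhd ?S p \<inter> nbhd ?S q) = k)" (is "_ \<longleftrightarrow> ?nonadj")
  proof
    assume c: "c4 \<and> c5"
    show ?nonadj
    proof (intro ballI impI)
      fix p q
      assume pq: "p \<in> pverts ?S" "q \<in> pverts ?S" "p \<noteq> q \<and> \<not> p \<rightarrow>\<^bsub>with_proj ?S\<^esub> q"
      obtain u i v j where "p = (u, i)" "q = (v, j)"
        by (cases p, cases q)
      then show "card (nbhd ?S p \<inter> nbhd ?S q) = k"
        using pq c same_adj[of u v i] dist_adj[of u v i j] same[of u v i] dist[of u v i j]
        \<comment> \<open>Within a layer, p \<noteq> q means u \<noteq> v, as (4) demands. Across
          layers, \<open>u = v\<close> is possible, and (5) allows it.\<close>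
        by (cases "i = j") (auto simp: c4_def c5_def)
    qed
  next
    assume nonadj: ?nonadj
    have c4
      unfolding c4_def
    proof (intro ballI impI)
      fix u v assume "u \<in> pverts G" "v \<in> pverts G" "u \<noteq> v \<and> \<not> u \<rightarrow>\<^bsub>with_proj G\<^esub> v"
      then show "card (nbhd G u \<inter> nbhd G v) + (m - 1) * card (dist_nbhd G x u \<inter> dist_nbhd G x v) = k"
        using layers same_adj[of u v 1] same[of u v 1] nonadj[rule_format, of "(u, 1)" "(v, 1)"]
        by simp
    qed
    moreover have c5
      unfolding c5_def
    proof (intro ballI impI)
      fix v w assume "v \<in> pverts G" "w \<in> pverts G" "w \<notin> dist_nbhd G x v"
      then show "card (nbhd G v \<inter> dist_nbhd G x w) + card (dist_nbhd G x v \<inter> nbhd G w)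
          + (m - 2) * card (dist_nbhd G x v \<inter> dist_nbhd G x w) = k"
        \<comment> \<open>The layer index alone makes the two copies distinct, so the case
          \<open>v = w\<close> needs no separate treatment.\<close>
        using layers dist_adj[of v w 1 2] dist[of v w 1 2] nonadj[rule_format, of "(v, 1)" "(w, 2)"]
        by simp
    qed
    ultimately show "c4 \<and> c5" ..
  qed
  have edge_regular: "c1 \<and> c2 \<and> c3 \<longleftrightarrow> ?S \<in> ER (m * n) d l"
    using S card_S regular adjacent by (simp add: ER_def)
  moreover have "c1 \<and> c2 \<and> c3 \<and> c4 \<and> c5 \<longleftrightarrow> ?S \<in> SR (m * n) d l k"
    using edge_regular nonadjacent by (auto simp: SR_def)
  ultimately show ?thesis
    using regular by blast
qed

end
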